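(* Let $H=(V,E)$ be a hypergraph with $|V|=n$, every edge having at least two vertices, with minimum edge size $k_{\min}$. Let $\lambda_n$ be the largest eigenvalue of the Laplacian $L$ of $H$, and define the max-cut $mc(H)=\max\{|\partial S|: S\subseteq V\}$. Then $$mc(H) \leq \frac{n \lambda_n}{4(k_{\min}-1)}.$$
   Context: For $V=\{1,\dots,n\}$, the adjacency matrix $A=(a_{ij})$ has $a_{ii}=0$ and, for $i\ne j$, $a_{ij}$ equal to the number of edges containing both $i$ and $j$. The Laplacian degree is $\delta_i=\sum_j a_{ij}$ and the Laplacian is $L=\mathrm{diag}(\delta_1,\dots,\delta_n)-A$, with largest eigenvalue $\lambda_n$. The edge boundary $\partial S$ is the set of edges $e\in E$ that intersect both $S$ and $V\setminus S$. *)

theory Defs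
  imports "Jordan_Normal_Form.Spectral_Radius"
begin

type_synonym hyperedges = "nat set set"

definition hypergraph :: "nat \<Rightarrow> hyperedges \<Rightarrow> bool" where
  "hypergraph n E \<longleftrightarrow> E \<subseteq> Pow {1..n}"

definition adj :: "hyperedges \<Rightarrow> nat \<Rightarrow> nat \<Rightarrow> nat" where
  "adj E i j = (if i = j then 0 else card {e \<in> E. i \<in> e \<and> j \<in> e})"

definition laplacian_degree :: "nat \<Rightarrow> hyperedges \<Rightarrow> nat \<Rightarrow> nat" where
  "laplacian_degree n E i = (\<Sum>j = 1..n. adj E i j)"

text \<open>Matrix indices run from \<open>0\<close> to \<open>n - 1\<close>; index \<open>i\<close> stands for the vertex \<open>i + 1\<close>.\<close>

definition adjacency_matrix :: "nat \<Rightarrow> hyperedges \<Rightarrow> real mat" where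
  "adjacency_matrix n E = mat n n (\<lambda>(i, j). real (adj E (i + 1) (j + 1)))"

definition laplacian :: "nat \<Rightarrow> hyperedges \<Rightarrow> real mat" where
  "laplacian n E = mat_diag n (\<lambda>i. real (laplacian_degree n E (i + 1))) - adjacency_matrix n E"

text \<open>The Laplacian is real symmetric, so its real spectrum is its whole spectrum; it is
  nonempty for \<open>n \<ge> 1\<close>.\<close>

definition largest_eigenvalue :: "real mat \<Rightarrow> real" where
  "largest_eigenvalue A = Max (spectrum A)"

definition edge_boundary :: "nat \<Rightarrow> hyperedges \<Rightarrow> nat set \<Rightarrow> nat set set" where
  "edge_boundary n E S = {e \<in> E. e \<inter> S \<noteq> {} \<and> e \<inter> ({1..n} - S) \<noteq> {}}"

definition max_cut :: "nat \<Rightarrow> hyperedges \<Rightarrow> nat" where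
  "max_cut n E = Max {card (edge_boundary n E S) | S. S \<subseteq> {1..n}}"

definition min_edge_size :: "hyperedges \<Rightarrow> nat" where
  "min_edge_size E = Min (card ` E)"

end

theory Submission
  imports Defs "HOL-Analysis.Function_Topology"
begin

text \<open>
  Evaluate the quadratic form of \<open>L\<close> at the vector \<open>x\<close> equal to \<open>1\<close> on \<open>S\<close> and \<open>-1\<close> off \<open>S\<close>.
  It equals \<open>4\<close> times the sum over the edges \<open>e\<close> of \<open>|e \<inter> S| |e - S|\<close>, and each edge of the boundary
  contributes at least \<open>|e| - 1\<close> to that sum. On the other hand the form is at most \<open>\<lambda>\<^sub>n |x|\<^sup>2 = n \<lambda>\<^sub>n\<close>,
  since the maximum of a symmetric form on the unit sphere is attained, by compactness, at an
  eigenvector.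
\<close>

section \<open>Compactness and maxima of quadratic forms on the unit sphere\<close>

text \<open>By Tychonoff's theorem. Vectors of length \<open>n\<close> are modelled as functions on
  all of \<open>nat\<close>; pinning the coordinates from \<open>n\<close> on to \<open>0\<close>
  makes every factor compact.\<close>

lemma compact_cube_functions:
  "compact {f :: nat \<Rightarrow> real. \<forall>i. f i \<in> (if i < n then {-1..1} else {0})}"
proof -
  have "compactin (product_topology (\<lambda>i. euclidean) UNIV)
    (PiE UNIV (\<lambda>i::nat. if i < n then {-1..1::real} else {0}))"
    by (subst compactin_PiE) auto
  then have "compact (PiE UNIV (\<lambda>i::nat. if i < n then {-1..1::real} else {0}))"
    by (simp add: euclidean_product_topology)
  also have "PiE UNIV (\<lambda>i::nat. if i < n then {-1..1::real} else {0})
    = {f. \<forall>i. f i \<in> (if i < n then {-1..1} else {0})}"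
    by (auto simp: PiE_def Pi_def)
  finally show ?thesis .
qed

lemma continuous_on_coordinate:
  "continuous_on S (\<lambda>f :: nat \<Rightarrow> real. f i)"
  by (rule continuous_on_subset[OF continuous_on_product_coordinates]) simp

text \<open>The sphere is a closed subset of the compact cube, and the form is continuous because it
  is a polynomial in finitely many coordinates.\<close>

lemma quadratic_form_attains_max_on_sphere:
  fixes a :: "nat \<Rightarrow> nat \<Rightarrow> real"
  assumes "n > 0"
  obtains v where "(\<Sum>i<n. (v i)\<^sup>2) = 1"
    and "\<And>x. (\<Sum>i<n. (x i)\<^sup>2) = 1 \<Longrightarrow>
      (\<Sum>i<n. \<Sum>j<n. a i j * x i * x j) \<le> (\<Sum>i<n. \<Sum>j<n. a i j * v i * v j)"
proof -
  define K where "K = {f :: nat \<Rightarrow> real. \<forall>i. f i \<in> (if i < n then {-1..1} else {0})}"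
  define S where "S = K \<inter> {f. (\<Sum>i<n. (f i)\<^sup>2) = 1}"
  let ?q = "\<lambda>f. \<Sum>i<n. \<Sum>j<n. a i j * f i * f j"
  have "closed {f :: nat \<Rightarrow> real. (\<Sum>i<n. (f i)\<^sup>2) = 1}"
    by (intro closed_Collect_eq continuous_intros continuous_on_coordinate)
  then have "compact S"
    unfolding S_def K_def using compact_cube_functions by (rule compact_Int_closed[rotated])
  \<comment> \<open>The first unit vector shows that the sphere is nonempty; this is where
    \<open>n > 0\<close> enters.\<close>
  moreover have "(\<lambda>i. if i = 0 then 1 else 0) \<in> S"
    using assms unfolding S_def K_def by (auto simp: if_distrib[of "\<lambda>x. x\<^sup>2"] cong: if_cong)
  then have "S \<noteq> {}" by blast
  moreover have "continuous_on S ?q"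
    by (intro continuous_intros continuous_on_coordinate)
  ultimately obtain v where v: "v \<in> S" and max: "\<And>x. x \<in> S \<Longrightarrow> ?q x \<le> ?q v"
    using continuous_attains_sup[of S ?q] by blast
  show thesis
  proof
    show "(\<Sum>i<n. (v i)\<^sup>2) = 1" using v by (simp add: S_def)
    fix x :: "nat \<Rightarrow> real" assume x: "(\<Sum>i<n. (x i)\<^sup>2) = 1"
    \<comment> \<open>\<open>x\<close> is arbitrary from \<open>n\<close> on, so it may lie outside
      the cube; truncating it leaves the norm and the form unchanged.\<close>
    define y where "y = (\<lambda>i. if i < n then x i else 0)"
    have "\<bar>x i\<bar> \<le> 1" if "i < n" for i
    proof -
      have "(x i)\<^sup>2 \<le> (\<Sum>i<n. (x i)\<^sup>2)"
        using that by (intro member_le_sum) auto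
      with x show ?thesis by (simp add: abs_square_le_1)
    qed
    then have "y \<in> S" using x by (force simp: S_def K_def y_def abs_le_iff)
    from max[OF this] show "?q x \<le> ?q v" by (simp add: y_def)
  qed
qed

section \<open>A maximizer of a symmetric form is an eigenvector\<close>

lemma nonneg_quadratic_imp_linear_coeff_zero:
  fixes b c :: real
  assumes "\<And>t. 0 \<le> 2 * t * b + t\<^sup>2 * c"
  shows "b = 0"
proof (rule ccontr)
  assume "b \<noteq> 0"
  \<comment> \<open>This is the minimizer of \<open>2 * t * b + t\<^sup>2 * C\<close> for
    \<open>C = \<bar>c\<bar> + 1\<close>; the summand \<open>1\<close> keeps \<open>C\<close>
    positive when \<open>c = 0\<close>.\<close>
  define t where "t = - b / (\<bar>c\<bar> + 1)"
  have "2 * t * b + t\<^sup>2 * c \<le> 2 * t * b + t\<^sup>2 * (\<bar>c\<bar> + 1)"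
    by (intro add_left_mono mult_left_mono) auto
  also have "\<dots> = - (b\<^sup>2 / (\<bar>c\<bar> + 1))"
    unfolding t_def by (simp add: divide_simps power2_eq_square)
  also have "\<dots> < 0" using \<open>b \<noteq> 0\<close> by simp
  finally show False using assms[of t] by simp
qed

text \<open>With \<mu> the maximum on the sphere, \<mu> times the squared norm minus the form is
  nonnegative everywhere and zero at the maximizer, so its first variation there vanishes. This is
  the eigenvector equation.\<close>

lemma symmetric_form_maximizer_eigenvector:
  fixes a :: "nat \<Rightarrow> nat \<Rightarrow> real"
  assumes "n > 0" and sym: "\<And>i j. i < n \<Longrightarrow> j < n \<Longrightarrow> a i j = a j i"
  obtains v \<mu> where "(\<Sum>i<n. (v i)\<^sup>2) = 1"
    and "\<And>i. i < n \<Longrightarrow> (\<Sum>j<n. a i j * v j) = \<mu> * v i"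
    and "\<And>x. (\<Sum>i<n. \<Sum>j<n. a i j * x i * x j) \<le> \<mu> * (\<Sum>i<n. (x i)\<^sup>2)"
proof -
  let ?q = "\<lambda>f. \<Sum>i<n. \<Sum>j<n. a i j * f i * f j"
  let ?s = "\<lambda>f. \<Sum>i<n. (f i :: real)\<^sup>2"
  obtain v where v1: "?s v = 1" and max: "\<And>x. ?s x = 1 \<Longrightarrow> ?q x \<le> ?q v"
    using quadratic_form_attains_max_on_sphere[OF assms(1), of a] by blast
  define \<mu> where "\<mu> = ?q v"
  have bound: "?q x \<le> \<mu> * ?s x" for x
  proof (cases "?s x = 0")
    case True
    then have "\<forall>i<n. x i = 0" by (simp add: sum_nonneg_eq_0_iff)
    with True show ?thesis by simp
  next
    case False
    \<comment> \<open>Both sides are homogeneous of degree 2, so the bound on the sphere carries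
      over by normalizing \<open>x\<close>.\<close>
    define r where "r = sqrt (?s x)"
    have s: "?s x > 0" using False by (simp add: sum_nonneg less_le)
    then have r: "r > 0" "r\<^sup>2 = ?s x" by (auto simp: r_def)
    have "?s (\<lambda>i. x i / r) = ?s x / r\<^sup>2"
      by (simp add: power_divide sum_divide_distrib)
    then have "?s (\<lambda>i. x i / r) = 1" using r s by simp
    from max[OF this] have "?q (\<lambda>i. x i / r) \<le> \<mu>" by (simp add: \<mu>_def)
    moreover have "?q (\<lambda>i. x i / r) = ?q x / r\<^sup>2"
      by (simp add: sum_divide_distrib power2_eq_square)
    ultimately show ?thesis using r s by (simp add: divide_le_eq)
  qed
  \<comment> \<open>The residual of the eigenvector equation. By symmetry it is half the gradient at
    \<open>v\<close> of the nonnegative difference, so varying \<open>v\<close> in this direction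
    gives a linear coefficient of \<open>2 * ?s w\<close>.\<close>
  define w where "w i = \<mu> * v i - (\<Sum>j<n. a i j * v j)" for i
  have q_expand: "?q (\<lambda>i. v i + t * w i)
      = ?q v + 2 * t * (\<Sum>i<n. w i * (\<Sum>j<n. a i j * v j)) + t\<^sup>2 * ?q w" for t
  proof -
    have "(\<Sum>i<n. \<Sum>j<n. a i j * v i * w j) = (\<Sum>i<n. \<Sum>j<n. a j i * v j * w i)"
      by (rule sum.swap)
    also have "\<dots> = (\<Sum>i<n. w i * (\<Sum>j<n. a i j * v j))"
      by (auto simp: sum_distrib_left sym intro!: sum.cong)
    finally have 1: "(\<Sum>i<n. \<Sum>j<n. a i j * v i * w j) = (\<Sum>i<n. w i * (\<Sum>j<n. a i j * v j))" .
    have 2: "(\<Sum>i<n. \<Sum>j<n. a i j * w i * v j) = (\<Sum>i<n. w i * (\<Sum>j<n. a i j * v j))"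
      by (auto simp: sum_distrib_left intro!: sum.cong)
    have "?q (\<lambda>i. v i + t * w i) = (\<Sum>i<n. \<Sum>j<n. a i j * v i * v j
        + (t * (a i j * v i * w j) + (t * (a i j * w i * v j) + t\<^sup>2 * (a i j * w i * w j))))"
      by (intro sum.cong refl) (simp add: algebra_simps power2_eq_square)
    also have "\<dots> = ?q v + (t * (\<Sum>i<n. \<Sum>j<n. a i j * v i * w j)
        + (t * (\<Sum>i<n. \<Sum>j<n. a i j * w i * v j) + t\<^sup>2 * ?q w))"
      by (simp add: sum.distrib sum_distrib_left)
    finally show ?thesis by (simp add: 1 2)
  qed
  have s_expand: "?s (\<lambda>i. v i + t * w i) = 1 + 2 * t * (\<Sum>i<n. w i * v i) + t\<^sup>2 * ?s w" for t
  proof -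
    have "?s (\<lambda>i. v i + t * w i) = (\<Sum>i<n. (v i)\<^sup>2 + (2 * t * (w i * v i) + t\<^sup>2 * (w i)\<^sup>2))"
      by (intro sum.cong refl) (simp add: algebra_simps power2_eq_square)
    also have "\<dots> = ?s v + (2 * t * (\<Sum>i<n. w i * v i) + t\<^sup>2 * ?s w)"
      by (simp add: sum.distrib sum_distrib_left)
    finally show ?thesis by (simp add: v1)
  qed
  have ww: "?s w = \<mu> * (\<Sum>i<n. w i * v i) - (\<Sum>i<n. w i * (\<Sum>j<n. a i j * v j))"
  proof -
    have "?s w = (\<Sum>i<n. \<mu> * (w i * v i) - w i * (\<Sum>j<n. a i j * v j))"
      by (intro sum.cong refl) (subst power2_eq_square, subst (2) w_def, simp add: algebra_simps)
    then show ?thesis by (simp add: sum_subtractf sum_distrib_left)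
  qed
  \<comment> \<open>The constant terms cancel because \<open>?s v = 1\<close> and
    \<open>?q v = \<mu>\<close>.\<close>
  have "0 \<le> 2 * t * ?s w + t\<^sup>2 * (\<mu> * ?s w - ?q w)" for t
  proof -
    have "0 \<le> \<mu> * ?s (\<lambda>i. v i + t * w i) - ?q (\<lambda>i. v i + t * w i)"
      using bound by simp
    also have "\<dots> = 2 * t * ?s w + t\<^sup>2 * (\<mu> * ?s w - ?q w)"
      unfolding q_expand s_expand \<mu>_def[symmetric] ww
      by (simp add: algebra_simps)
    finally show ?thesis .
  qed
  then have "?s w = 0" by (rule nonneg_quadratic_imp_linear_coeff_zero)
  then have "\<forall>i<n. w i = 0" by (simp add: sum_nonneg_eq_0_iff)
  then have "(\<Sum>j<n. a i j * v j) = \<mu> * v i" if "i < n" for i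
    using that by (simp add: w_def)
  then show thesis using that v1 bound by blast
qed

text \<open>The maximum of the form on the sphere is an eigenvalue, hence at most the
  \<open>Max\<close> of the finite spectrum. Nonemptiness is recorded as well, since
  \<open>Max {}\<close> is unspecified.\<close>

lemma symmetric_mat_rayleigh_bound:
  fixes A :: "real mat"
  assumes A: "A \<in> carrier_mat n n" and "n > 0"
    and sym: "\<And>i j. i < n \<Longrightarrow> j < n \<Longrightarrow> A $$ (i, j) = A $$ (j, i)"
  shows "spectrum A \<noteq> {}"
    and "(\<Sum>i<n. \<Sum>j<n. A $$ (i, j) * x i * x j) \<le> largest_eigenvalue A * (\<Sum>i<n. (x i)\<^sup>2)"
proof -
  obtain v \<mu> where v: "(\<Sum>i<n. (v i)\<^sup>2) = 1"
    and eig: "\<And>i. i < n \<Longrightarrow> (\<Sum>j<n. A $$ (i, j) * v j) = \<mu> * v i"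
    and bound: "\<And>x. (\<Sum>i<n. \<Sum>j<n. A $$ (i, j) * x i * x j) \<le> \<mu> * (\<Sum>i<n. (x i)\<^sup>2)"
    using symmetric_form_maximizer_eigenvector[of n "\<lambda>i j. A $$ (i, j)"] assms by blast
  have "vec n v \<noteq> 0\<^sub>v n"
  proof
    assume "vec n v = 0\<^sub>v n"
    then have "v i = 0" if "i < n" for i
      using that by (metis index_vec index_zero_vec(1))
    then show False using v by simp
  qed
  moreover have "A *\<^sub>v vec n v = \<mu> \<cdot>\<^sub>v vec n v"
    using A eig by (intro eq_vecI) (auto simp: scalar_prod_def lessThan_atLeast0)
  ultimately have "eigenvector A (vec n v) \<mu>"
    using A by (auto simp: eigenvector_def)
  then have mem: "\<mu> \<in> spectrum A"
    by (auto simp: spectrum_def eigenvalue_def)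
  then show "spectrum A \<noteq> {}" by blast
  have "\<mu> \<le> largest_eigenvalue A"
    unfolding largest_eigenvalue_def using card_finite_spectrum(1)[OF A] mem by (rule Max_ge)
  then have "\<mu> * (\<Sum>i<n. (x i)\<^sup>2) \<le> largest_eigenvalue A * (\<Sum>i<n. (x i)\<^sup>2)"
    by (intro mult_right_mono sum_nonneg) auto
  with bound[of x] show "(\<Sum>i<n. \<Sum>j<n. A $$ (i, j) * x i * x j)
    \<le> largest_eigenvalue A * (\<Sum>i<n. (x i)\<^sup>2)" by linarith
qed

section \<open>The quadratic form of the Laplacian\<close>

lemma laplacian_carrier: "laplacian n E \<in> carrier_mat n n"
  unfolding laplacian_def adjacency_matrix_def by (intro minus_carrier_mat mat_carrier)

lemma laplacian_index:
  assumes "i < n" "j < n"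
  shows "laplacian n E $$ (i, j)
    = (if i = j then real (laplacian_degree n E (i + 1)) else 0) - real (adj E (i + 1) (j + 1))"
  using assms by (simp add: laplacian_def adjacency_matrix_def mat_diag_def)

lemma adj_commute: "adj E i j = adj E j i"
  by (simp add: adj_def conj_commute)

lemma sum_shift_vertices:
  fixes n :: nat
  shows "(\<Sum>i<n. f (i + 1)) = (\<Sum>i = 1..n. f i)"
  by (rule sum.reindex_bij_witness[of _ "\<lambda>i. i - 1" "\<lambda>i. i + 1"]) auto

text \<open>Writing each degree as a row sum of \<open>adj\<close> spreads the diagonal term over
  the ordered pairs of vertices. For entries 1 and -1 the factor of a pair is then 2 if the signs
  differ and 0 otherwise.\<close>

lemma laplacian_quadratic_form:
  fixes x :: "nat \<Rightarrow> real"
  shows "(\<Sum>i<n. \<Sum>j<n. laplacian n E $$ (i, j) * x (i + 1) * x (j + 1))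
    = (\<Sum>i = 1..n. \<Sum>j = 1..n. real (adj E i j) * ((x i)\<^sup>2 - x i * x j))"
proof -
  have "(\<Sum>j<n. laplacian n E $$ (i, j) * x (i + 1) * x (j + 1))
    = (\<Sum>j = 1..n. real (adj E (i + 1) j) * ((x (i + 1))\<^sup>2 - x (i + 1) * x j))"
    if i: "i < n" for i
  proof -
    have "(\<Sum>j<n. laplacian n E $$ (i, j) * x (i + 1) * x (j + 1))
      = (\<Sum>j<n. (if i = j then real (laplacian_degree n E (i + 1)) * (x (i + 1))\<^sup>2 else 0)
        - real (adj E (i + 1) (j + 1)) * (x (i + 1) * x (j + 1)))"
      using i by (intro sum.cong refl)
        (auto simp: laplacian_index algebra_simps power2_eq_square)
    also have "\<dots> = real (laplacian_degree n E (i + 1)) * (x (i + 1))\<^sup>2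
        - (\<Sum>j<n. real (adj E (i + 1) (j + 1)) * (x (i + 1) * x (j + 1)))"
      using i by (simp add: sum_subtractf)
    also have "(\<Sum>j<n. real (adj E (i + 1) (j + 1)) * (x (i + 1) * x (j + 1)))
        = (\<Sum>j = 1..n. real (adj E (i + 1) j) * (x (i + 1) * x j))"
      by (rule sum_shift_vertices)
    finally show ?thesis
      by (simp add: laplacian_degree_def sum_distrib_right sum_subtractf right_diff_distrib)
  qed
  then have "(\<Sum>i<n. \<Sum>j<n. laplacian n E $$ (i, j) * x (i + 1) * x (j + 1))
    = (\<Sum>i<n. \<Sum>j = 1..n. real (adj E (i + 1) j) * ((x (i + 1))\<^sup>2 - x (i + 1) * x j))"
    by (rule sum.cong[OF refl]) (simp only: lessThan_iff)
  also have "\<dots> = (\<Sum>i = 1..n. \<Sum>j = 1..n. real (adj E i j) * ((x i)\<^sup>2 - x i * x j))"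
    by (rule sum_shift_vertices)
  finally show ?thesis .
qed

section \<open>Counting pairs of vertices across a cut\<close>

text \<open>Both sides count the triples of an edge \<open>e\<close>, a vertex of \<open>e\<close>
  in \<open>S\<close> and a vertex of \<open>e\<close> outside \<open>S\<close>.\<close>

lemma sum_adj_across_cut:
  assumes "hypergraph n E" "S \<subseteq> {1..n}"
  shows "(\<Sum>i\<in>S. \<Sum>j\<in>{1..n} - S. adj E i j) = (\<Sum>e\<in>E. card (e \<inter> S) * card (e - S))"
proof -
  have fin: "finite E"
    using assms(1) unfolding hypergraph_def by (rule finite_subset) simp
  have finS: "finite S" using assms(2) by (rule finite_subset) simp
  have "(\<Sum>i\<in>S. \<Sum>j\<in>{1..n} - S. adj E i j)
    = (\<Sum>i\<in>S. \<Sum>j\<in>{1..n} - S. \<Sum>e\<in>E. of_bool (i \<in> e) * of_bool (j \<in> e))"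
  proof (intro sum.cong refl)
    fix i j assume "i \<in> S" "j \<in> {1..n} - S"
    \<comment> \<open>Vertices on opposite sides of the cut are distinct, so the zero diagonal of
      \<open>adj\<close> does not interfere.\<close>
    then have "adj E i j = card {e \<in> E. i \<in> e \<and> j \<in> e}" by (auto simp: adj_def)
    also have "\<dots> = (\<Sum>e\<in>E. of_bool (i \<in> e \<and> j \<in> e))"
      using fin by (simp add: sum_of_bool_eq Collect_conj_eq)
    finally show "adj E i j = (\<Sum>e\<in>E. of_bool (i \<in> e) * of_bool (j \<in> e))"
      by (simp add: of_bool_conj)
  qed
  also have "\<dots> = (\<Sum>i\<in>S. \<Sum>e\<in>E. \<Sum>j\<in>{1..n} - S. of_bool (i \<in> e) * of_bool (j \<in> e))"
    by (intro sum.cong refl sum.swap)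
  also have "\<dots> = (\<Sum>e\<in>E. \<Sum>i\<in>S. \<Sum>j\<in>{1..n} - S. of_bool (i \<in> e) * of_bool (j \<in> e))"
    by (rule sum.swap)
  also have "\<dots> = (\<Sum>e\<in>E. card (e \<inter> S) * card (e - S))"
  proof (intro sum.cong refl)
    fix e assume "e \<in> E"
    then have "e \<subseteq> {1..n}" using assms(1) by (auto simp: hypergraph_def)
    then have "e - S = ({1..n} - S) \<inter> {j. j \<in> e}" by auto
    moreover have "e \<inter> S = S \<inter> {i. i \<in> e}" by auto
    ultimately have "card (e \<inter> S) * card (e - S)
      = (\<Sum>i\<in>S. of_bool (i \<in> e)) * (\<Sum>j\<in>{1..n} - S. of_bool (j \<in> e))"
      using finS by (simp add: sum_of_bool_eq)
    then show "(\<Sum>i\<in>S. \<Sum>j\<in>{1..n} - S. of_bool (i \<in> e) * of_bool (j \<in> e))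
      = card (e \<inter> S) * card (e - S)"
      by (simp only: sum_product)
  qed
  finally show ?thesis .
qed

text \<open>For parts of sizes \<open>p + 1\<close> and \<open>q + 1\<close> the product exceeds
  \<open>p + q + 1\<close> by \<open>p * q\<close>.\<close>

lemma card_minus_one_le_split_product:
  assumes "finite e" "e \<inter> S \<noteq> {}" "e - S \<noteq> {}"
  shows "card e - 1 \<le> card (e \<inter> S) * card (e - S)"
proof -
  have "card (e \<inter> S) > 0" "card (e - S) > 0"
    using assms by (auto simp: card_gt_0_iff)
  moreover have "card e = card (e \<inter> S) + card (e - S)"
    using card_Un_disjoint[of "e \<inter> S" "e - S"] assms(1) by (simp add: Int_Diff_Un Int_Diff_disjoint)
  moreover obtain p q where "card (e \<inter> S) = Suc p" "card (e - S) = Suc q"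
    using calculation by (metis gr0_implies_Suc)
  ultimately show ?thesis by simp
qed

text \<open>In the count by edges, each boundary edge contributes at least its size minus one, and
  the other edges can only add to the total.\<close>

lemma edge_boundary_le_sum_adj:
  assumes "hypergraph n E" "S \<subseteq> {1..n}"
  shows "card (edge_boundary n E S) * (min_edge_size E - 1)
    \<le> (\<Sum>i\<in>S. \<Sum>j\<in>{1..n} - S. adj E i j)"
proof -
  have fin: "finite E"
    using assms(1) unfolding hypergraph_def by (rule finite_subset) simp
  have sub: "edge_boundary n E S \<subseteq> E" by (auto simp: edge_boundary_def)
  have "card (edge_boundary n E S) * (min_edge_size E - 1)
    = (\<Sum>e\<in>edge_boundary n E S. min_edge_size E - 1)" by simp
  also have "\<dots> \<le> (\<Sum>e\<in>edge_boundary n E S. card (e \<inter> S) * card (e - S))"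
  proof (rule sum_mono)
    fix e assume e: "e \<in> edge_boundary n E S"
    then have "e \<in> E" using sub by blast
    then have "finite e" using assms(1) by (auto simp: hypergraph_def intro: finite_subset)
    have "min_edge_size E \<le> card e"
      using fin \<open>e \<in> E\<close> by (simp add: min_edge_size_def)
    moreover have "card e - 1 \<le> card (e \<inter> S) * card (e - S)"
      using e \<open>finite e\<close> by (intro card_minus_one_le_split_product) (auto simp: edge_boundary_def)
    ultimately show "min_edge_size E - 1 \<le> card (e \<inter> S) * card (e - S)" by linarith
  qed
  also have "\<dots> \<le> (\<Sum>e\<in>E. card (e \<inter> S) * card (e - S))"
    using fin sub by (intro sum_mono2) auto
  finally show ?thesis using sum_adj_across_cut[OF assms] by simp
qed

section \<open>The eigenvalue bound for cuts and the conclusion\<close>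

lemma sum_adj_across_cut_le:
  assumes "n > 0" "S \<subseteq> {1..n}"
  shows "4 * real (\<Sum>i\<in>S. \<Sum>j\<in>{1..n} - S. adj E i j)
    \<le> real n * largest_eigenvalue (laplacian n E)"
proof -
  define x where "x i = (if i \<in> S then 1 else -1 :: real)" for i
  let ?V = "{1..n}" and ?a = "\<lambda>i j. real (adj E i j)"
  have split: "(\<Sum>i\<in>?V. f i) = (\<Sum>i\<in>S. f i) + (\<Sum>i\<in>?V - S. f i)" for f :: "nat \<Rightarrow> real"
    using sum.subset_diff[OF assms(2), of f] by simp
  \<comment> \<open>Pairs on the same side vanish and crossing pairs have factor 2. Each crossing
    pair occurs in both orders, which yields the constant 4.\<close>
  have "(\<Sum>i\<in>?V. \<Sum>j\<in>?V. ?a i j * ((x i)\<^sup>2 - x i * x j))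
    = 2 * (\<Sum>i\<in>S. \<Sum>j\<in>?V - S. ?a i j) + 2 * (\<Sum>i\<in>?V - S. \<Sum>j\<in>S. ?a i j)"
    unfolding split by (simp add: x_def sum.distrib sum_distrib_left mult.commute)
  also have "(\<Sum>i\<in>?V - S. \<Sum>j\<in>S. ?a i j) = (\<Sum>i\<in>S. \<Sum>j\<in>?V - S. ?a i j)"
    by (subst sum.swap) (simp add: adj_commute)
  finally have "4 * real (\<Sum>i\<in>S. \<Sum>j\<in>?V - S. adj E i j)
    = (\<Sum>i<n. \<Sum>j<n. laplacian n E $$ (i, j) * x (i + 1) * x (j + 1))"
    unfolding laplacian_quadratic_form by simp
  also have "\<dots> \<le> largest_eigenvalue (laplacian n E) * (\<Sum>i<n. (x (i + 1))\<^sup>2)"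
    using assms(1) by (intro symmetric_mat_rayleigh_bound(2) laplacian_carrier)
      (auto simp: laplacian_index adj_commute)
  also have "(\<Sum>i<n. (x (i + 1))\<^sup>2) = real n"
    by (simp add: x_def if_distrib[of "\<lambda>y. y\<^sup>2"] cong: if_cong)
  finally show ?thesis by (simp add: mult.commute)
qed

text \<open>Without edges the Laplacian is the zero matrix, whose only eigenvalue is 0. Positivity
  of \<open>n\<close> ensures that the spectrum is nonempty.\<close>

lemma largest_eigenvalue_laplacian_no_edges:
  assumes "n > 0"
  shows "largest_eigenvalue (laplacian n {}) = 0"
proof -
  have L: "laplacian n {} = 0\<^sub>m n n"
    using laplacian_carrier[of n "{}"]
    by (intro eq_matI) (auto simp: laplacian_index laplacian_degree_def adj_def)
  have "k = 0" if "k \<in> spectrum (0\<^sub>m n n :: real mat)" for k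
  proof -
    from that obtain v where v: "v \<in> carrier_vec n" "v \<noteq> 0\<^sub>v n" "0\<^sub>m n n *\<^sub>v v = k \<cdot>\<^sub>v v"
      by (auto simp: spectrum_def eigenvalue_def eigenvector_def)
    then obtain i where i: "i < n" "v $ i \<noteq> 0" by (metis carrier_vecD eq_vecI index_zero_vec)
    have "(0\<^sub>m n n *\<^sub>v v) $ i = 0" using v(1) i(1) by simp
    then have "(k \<cdot>\<^sub>v v) $ i = 0" by (simp only: v(3))
    then show ?thesis using v(1) i by simp
  qed
  moreover have "spectrum (0\<^sub>m n n :: real mat) \<noteq> {}"
    using assms by (intro symmetric_mat_rayleigh_bound(1)[of _ n]) auto
  ultimately have "spectrum (0\<^sub>m n n :: real mat) = {0}" by blast
  then show ?thesis by (simp add: L largest_eigenvalue_def)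
qed

lemma max_cut_attained:
  obtains S where "S \<subseteq> {1..n}" "max_cut n E = card (edge_boundary n E S)"
proof -
  have "{card (edge_boundary n E S) | S. S \<subseteq> {1..n}}
    = (\<lambda>S. card (edge_boundary n E S)) ` Pow {1..n}" by auto
  then have "max_cut n E \<in> (\<lambda>S. card (edge_boundary n E S)) ` Pow {1..n}"
    unfolding max_cut_def by (metis Max_in Pow_not_empty finite_Pow_iff finite_atLeastAtMost
        finite_imageI image_is_empty)
  then show thesis using that by blast
qed

theorem theorem3p3:
  fixes n :: nat and E :: "nat set set"
  assumes "hypergraph n E"
    and "\<forall>e\<in>E. card e \<ge> 2"
  shows "real (max_cut n E)
    \<le> real n * largest_eigenvalue (laplacian n E) / (4 * (real (min_edge_size E) - 1))"
proof -
  obtain S where S: "S \<subseteq> {1..n}" and mc: "max_cut n E = card (edge_boundary n E S)"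
    by (rule max_cut_attained)
  show ?thesis
  proof (cases "E = {}")
    case True
    \<comment> \<open>Here the minimum edge size is the junk value \<open>Min {}\<close>, so the numerator has to vanish.\<close>
    then show ?thesis
      using mc largest_eigenvalue_laplacian_no_edges[of n]
      by (cases "n = 0") (auto simp: edge_boundary_def)
  next
    case False
    have fin: "finite E"
      using assms(1) unfolding hypergraph_def by (rule finite_subset) simp
    have k: "min_edge_size E \<ge> 2"
      using assms(2) fin False by (auto simp: min_edge_size_def)
    have "n > 0"
    proof (rule ccontr)
      assume "\<not> n > 0"
      then have "E \<subseteq> {{}}" using assms(1) by (simp add: hypergraph_def)
      then show False using False assms(2) by fastforce
    qed
    \<comment> \<open>The subtraction on the right is the truncated one on \<open>nat\<close>; it
      agrees with the real one because \<open>k\<close> bounds the minimum edge size below by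
      2.\<close>
    have "real (max_cut n E) * (4 * (real (min_edge_size E) - 1))
      = 4 * real (card (edge_boundary n E S) * (min_edge_size E - 1))"
      using k mc by (simp add: of_nat_diff)
    also have "\<dots> \<le> 4 * real (\<Sum>i\<in>S. \<Sum>j\<in>{1..n} - S. adj E i j)"
      using edge_boundary_le_sum_adj[OF assms(1) S] by (intro mult_left_mono of_nat_mono) auto
    also have "\<dots> \<le> real n * largest_eigenvalue (laplacian n E)"
      by (rule sum_adj_across_cut_le[OF \<open>n > 0\<close> S])
    finally show ?thesis using k by (simp add: pos_le_divide_eq)
  qed
qed

end
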